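(* Given $\varepsilon>0$ and assuming that $n>d^2$, the total computational cost $\mathcal{C}(m)$ of PCG with a fixed Gaussian embedding to reach an $(\varepsilon,e^{-\mathcal{O}(d)})$-accurate solution with sketch size $m^*=d\cdot\exp\!\big(W(\tfrac{n}{d^2}\log(1/\varepsilon))\big)$ satisfies $$\mathcal{C}(m^* )=\mathcal{O}\Big(nd\cdot\frac{\log(1/\varepsilon)}{\log(n/d^2)}\Big) .$$
   Context: Problem: minimize $f(x)=\frac12\|Ax\|_2^2-\langle b,x\rangle$ over $x\in\mathbb{R}^d$, with $A\in\mathbb{R}^{n\times d}$ of full column rank, $b\in\mathbb{R}^d$ and minimizer $x^*$, using the preconditioned conjugate gradient method (PCG) started at $x_0$ with the fixed preconditioner $A^\top S^\top SA$, where $S\in\mathbb{R}^{m\times n}$ is a Gaussian embedding, i.e. has i.i.d. $\mathcal{N}(0,1/m)$ entries. An approximate solution $x_t$ is $(\varepsilon,\delta)$-accurate if its relative error $\|A(x_t-x^* )\|_2^2/\|A(x_0-x^* )\|_2^2$ is at most $\varepsilon$ with probability $1-\delta$. Cost model (flop count in an idealized RAM model, numerical constants discarded): for failure probability $\delta=e^{-\mathcal{O}(d)}$, the critical sketch size is of order $d$; forming $SA$ is assumed to take time $\mathcal{O}(nd)$ through parallelization (communication costs ignored), which is neglected compared to the other terms; the matrix factorization for the preconditioner costs $md^2$; each PCG iteration costs $nd$, and about $\log(1/\varepsilon)/\log(m/d)$ iterations are needed. The cost function is therefore $$\mathcal{C}(m)=md^2+nd\,\frac{\log(1/\varepsilon)}{\log(m/d)}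 .$$ For a real number $a>0$, the Lambert function $W(a)$ is the unique real solution of $W(a)e^{W(a)}=a$. *)

theory Defs
  imports Complex_Main "HOL-Library.Landau_Symbols"
begin

text \<open>Only meaningful for \<open>a > 0\<close>, where \<open>Lambert_W_ex1\<close> gives existence and uniqueness over the reals.\<close>
definition Lambert_W :: "real \<Rightarrow> real" where
  "Lambert_W a = (THE w. w * exp w = a)"

lemma Lambert_W_ex1:
  fixes a :: real
  assumes "a > 0"
  shows "\<exists>!w. w * exp w = a"
proof -
  have "\<exists>w. 0 \<le> w \<and> w \<le> a \<and> w * exp w = a"
    using assms by (intro IVT') (auto intro!: continuous_intros)
  moreover have "u < v \<Longrightarrow> u * exp u = a \<Longrightarrow> v * exp v \<noteq> a" for u v :: real
  proof -
    assume "u < v" and u: "u * exp u = a"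
    from u assms have "u > 0" by (metis exp_gt_zero zero_less_mult_pos2)
    with \<open>u < v\<close> have "u * exp u < v * exp v"
      by (intro mult_strict_mono) auto
    with u show ?thesis by simp
  qed
  ultimately show ?thesis by (metis linorder_neqE_linordered_idom)
qed

text \<open>
  Flop count of the cost model for PCG with a fixed Gaussian sketch of size \<open>m\<close>, for an
  \<open>n \<times> d\<close> matrix and target relative error \<open>\<epsilon>\<close>, at failure probability \<open>exp (- O(d))\<close>: factorizing
  the preconditioner costs \<open>m d\<^sup>2\<close>, and \<open>ln (1 / \<epsilon>) / ln (m / d)\<close> iterations cost \<open>n d\<close> each;
  forming the sketch is neglected. The sketch size is a real number, since the model is evaluated
  at the possibly non-integer \<open>opt_sketch_size\<close>.
\<close>
definition pcg_cost :: "real \<Rightarrow> nat \<Rightarrow> nat \<Rightarrow> real \<Rightarrow> real" where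
  "pcg_cost \<epsilon> n d m =
     m * real d ^ 2 + real n * real d * (ln (1 / \<epsilon>) / ln (m / real d))"

definition opt_sketch_size :: "real \<Rightarrow> nat \<Rightarrow> nat \<Rightarrow> real" where
  "opt_sketch_size \<epsilon> n d =
     real d * exp (Lambert_W (real n / real d ^ 2 * ln (1 / \<epsilon>)))"

text \<open>
  The admissible parameters. \<open>\<epsilon> < 1\<close> is what makes the argument \<open>n / d\<^sup>2 * ln (1 / \<epsilon>)\<close> of \<open>Lambert_W\<close>
  positive. The big-O estimate is uniform in \<open>n\<close>, \<open>d\<close> and in \<open>\<epsilon> \<le> \<epsilon>\<^sub>0\<close> for every fixed
  \<open>\<epsilon>\<^sub>0 < 1\<close>; taking \<open>\<epsilon>\<^sub>0 = \<epsilon>\<close> gives the estimate for a single given \<open>\<epsilon>\<close>.  No constant works for all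
  \<open>\<epsilon>\<close> in \<open>(0, 1)\<close> at once: for \<open>n / d\<^sup>2\<close> close to \<open>1 / ln (1 / \<epsilon>)\<close>, the ratio of the two sides grows
  without bound as \<open>\<epsilon>\<close> tends to 1. A big-O over \<open>principal X\<close> means that one constant serves on all
  of \<open>X\<close>, with no limit taken.
\<close>
definition pcg_params :: "real \<Rightarrow> (real \<times> nat \<times> nat) set" where
  "pcg_params \<epsilon>\<^sub>0 = {(\<epsilon>, n, d). 0 < \<epsilon> \<and> \<epsilon> \<le> \<epsilon>\<^sub>0 \<and> 1 \<le> d \<and> n > d ^ 2}"

end

(* With a = (n / d^2) ln (1 / eps) and w = W(a), the equation w e^w = a makes the factorization
   cost d^3 e^w equal to the iteration cost n d ln (1 / eps) / w, so the total is twice the latter.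
   It remains to bound ln (n / d^2) by a multiple of w: n / d^2 = w e^w / ln (1 / eps) gives
   ln (n / d^2) <= w + ln (w / L) <= (1 + 1 / L) w for every positive lower bound L of
   ln (1 / eps). *)
theory Submission
  imports Defs
begin

lemma Lambert_W_times_exp:
  assumes "a > 0"
  shows "Lambert_W a * exp (Lambert_W a) = a"
  unfolding Lambert_W_def by (rule theI'[OF Lambert_W_ex1[OF assms]])

lemma Lambert_W_pos:
  assumes "a > 0"
  shows "Lambert_W a > 0"
  using Lambert_W_times_exp[OF assms] assms by (metis exp_gt_zero zero_less_mult_pos2)

text \<open>The factor is built from a lower bound \<open>L\<^sub>0\<close> instead of
  \<open>L\<close> itself, so that one constant serves all \<open>L\<close> above it; this gives the
  uniformity in \<epsilon>.\<close>

lemma ln_le_Lambert_W: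
  fixes r L\<^sub>0 L :: real
  assumes "r > 0" "L\<^sub>0 > 0" "L\<^sub>0 \<le> L"
  shows "ln r \<le> (1 + 1 / L\<^sub>0) * Lambert_W (r * L)"
proof -
  define w where "w = Lambert_W (r * L)"
  have "r * L > 0" using assms by simp
  then have w: "w > 0" "w * exp w = r * L"
    unfolding w_def by (rule Lambert_W_pos, rule Lambert_W_times_exp)
  \<comment> \<open>Only the explicit \<open>L\<close> is weakened to \<open>L\<^sub>0\<close>;
    \<open>w\<close> still belongs to \<open>r * L\<close>.\<close>
  have "r * L\<^sub>0 \<le> w * exp w"
    using w(2) assms by (simp add: mult_left_mono)
  then have "r \<le> w / L\<^sub>0 * exp w"
    using assms by (simp add: field_simps)
  then have "ln r \<le> ln (w / L\<^sub>0 * exp w)"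
    using assms(1) by (meson ln_mono)
  also have "\<dots> = ln (w / L\<^sub>0) + w"
    using w(1) assms(2) ln_mult[of "w / L\<^sub>0" "exp w"] by simp
  also have "\<dots> \<le> w / L\<^sub>0 + w"
    using w(1) assms(2) ln_le_minus_one[of "w / L\<^sub>0"] by simp
  finally show ?thesis
    by (simp add: w_def algebra_simps)
qed

lemma pcg_cost_opt_sketch_size:
  assumes "0 < \<epsilon>" "\<epsilon> < 1" "n > 0" "d > 0"
  shows "pcg_cost \<epsilon> n d (opt_sketch_size \<epsilon> n d) =
    2 * (real n * real d * (ln (1 / \<epsilon>) / Lambert_W (real n / real d ^ 2 * ln (1 / \<epsilon>))))"
proof -
  define L where "L = ln (1 / \<epsilon>)"
  define w where "w = Lambert_W (real n / real d ^ 2 * L)"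
  have "real n / real d ^ 2 * L > 0"
    using assms unfolding L_def by (intro mult_pos_pos divide_pos_pos ln_gt_zero) auto
  then have w: "w > 0" "w * exp w = real n / real d ^ 2 * L"
    unfolding w_def by (rule Lambert_W_pos, rule Lambert_W_times_exp)
  have "exp w = real n / real d ^ 2 * L / w"
    unfolding w(2)[symmetric] using w(1) by simp
  then have "real d * exp w * real d ^ 2 = real n * real d * (L / w)"
    using assms(4) by (simp add: field_simps)
  \<comment> \<open>The sketch size is d times \<open>exp w\<close>, so the iteration count has
    denominator exactly \<open>w\<close>.\<close>
  moreover have "ln (real d * exp w / real d) = w"
    using assms(4) by simp
  ultimately show ?thesis
    unfolding pcg_cost_def opt_sketch_size_def L_def[symmetric] w_def[symmetric] by simp
qed

theorem theorem6p2:
  fixes \<epsilon>\<^sub>0 :: real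
  assumes "0 < \<epsilon>\<^sub>0" and "\<epsilon>\<^sub>0 < 1"
  shows "(\<lambda>(\<epsilon>, n, d). pcg_cost \<epsilon> n d (opt_sketch_size \<epsilon> n d))
           \<in> O[principal (pcg_params \<epsilon>\<^sub>0)](\<lambda>(\<epsilon>, n, d). real n * real d * (ln (1 / \<epsilon>) / ln (real n / real d ^ 2)))"
proof -
  define L\<^sub>0 where "L\<^sub>0 = ln (1 / \<epsilon>\<^sub>0)"
  \<comment> \<open>The factor from \<open>ln_le_Lambert_W\<close>, depending on
    \<open>\<epsilon>\<^sub>0\<close> alone. The 2 in \<open>2 * C\<close> counts the two equal cost
    terms.\<close>
  define C where "C = 1 + 1 / L\<^sub>0"
  have L0: "L\<^sub>0 > 0"
    using assms by (simp add: L\<^sub>0_def)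
  have bound: "norm (pcg_cost \<epsilon> n d (opt_sketch_size \<epsilon> n d))
      \<le> 2 * C * norm (real n * real d * (ln (1 / \<epsilon>) / ln (real n / real d ^ 2)))"
    if "(\<epsilon>, n, d) \<in> pcg_params \<epsilon>\<^sub>0" for \<epsilon> n d
  proof -
    define L where "L = ln (1 / \<epsilon>)"
    define r where "r = real n / real d ^ 2"
    define w where "w = Lambert_W (r * L)"
    have \<epsilon>: "0 < \<epsilon>" "\<epsilon> \<le> \<epsilon>\<^sub>0" and d: "d > 0" and n: "n > d ^ 2"
      using that by (auto simp: pcg_params_def)
    have "L\<^sub>0 \<le> L"
      using \<epsilon> assms by (simp add: L_def L\<^sub>0_def ln_div)
    then have "L > 0" using L0 by simp
    have "real d ^ 2 < real n"
      using n by (metis of_nat_less_iff of_nat_power)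
    then have "r > 1"
      using d by (simp add: r_def)
    then have "ln r > 0" by simp
    have "w > 0"
      unfolding w_def using \<open>r > 1\<close> \<open>L > 0\<close> by (intro Lambert_W_pos) simp
    have "ln r \<le> C * w"
      unfolding C_def w_def using \<open>r > 1\<close> L0 \<open>L\<^sub>0 \<le> L\<close> by (intro ln_le_Lambert_W) auto
    then have "1 / w \<le> C / ln r"
      using \<open>w > 0\<close> \<open>ln r > 0\<close> by (simp add: field_simps)
    then have "2 * (real n * real d * L) * (1 / w) \<le> 2 * (real n * real d * L) * (C / ln r)"
      using \<open>L > 0\<close> by (intro mult_left_mono) auto
    moreover have "pcg_cost \<epsilon> n d (opt_sketch_size \<epsilon> n d) = 2 * (real n * real d * (L / w))"
      unfolding w_def r_def L_def using \<epsilon> assms d n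
      by (intro pcg_cost_opt_sketch_size) auto
    ultimately show ?thesis
      unfolding L_def[symmetric] r_def[symmetric]
      using \<open>L > 0\<close> \<open>w > 0\<close> \<open>ln r > 0\<close> by (simp add: abs_mult mult_ac)
  qed
  show ?thesis
    \<comment> \<open>For a principal filter, eventually means everywhere on the set, so the
      pointwise bound is all that is required.\<close>
    by (rule bigoI[where c = "2 * C"]) (use bound in \<open>auto simp: eventually_principal\<close>)
qed

end
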